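(* Suppose that $\mu$ and $\kappa$ are infinite cardinals, with $\kappa$ regular. If $\mathcal G=(\kappa,E)$ is a graph and, for every $\alpha<\kappa$, $\mathrm{Col}(\mathcal G_\alpha)\le\mu$, then $\mathrm{Col}(\mathcal G)\le\mu^{++}$.
   Context: A graph is a pair $\mathcal G=(V,E)$ with $E\subseteq[V]^2$. The coloring number $\mathrm{Col}(\mathcal G)$ is the least cardinal $\nu$ for which there exists a well-ordering $\lhd$ of $V$ such that $|\{y\in V\mid\{x,y\}\in E,\ y\lhd x\}|<\nu$ for all $x\in V$. For a graph $\mathcal G=(\kappa,E)$ and $\alpha<\kappa$, $\mathcal G_\alpha$ is the induced subgraph $(\alpha,E\cap[\alpha]^2)$. *)

theory Defs
  imports Main "HOL-Library.Ramsey"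
begin

unbundle cardinal_syntax

text \<open>
  Cardinals are represented, as in the library, by relations \<open>r\<close> with \<open>Card_order r\<close>
  (well-orders of minimal order type), compared across types by \<open>\<le>o\<close> and \<open><o\<close>.
\<close>

definition is_graph :: "'a set \<Rightarrow> 'a set set \<Rightarrow> bool" where
  "is_graph V E \<longleftrightarrow> E \<subseteq> [V]\<^bsup>2\<^esup>"

definition induced_edges :: "'a set set \<Rightarrow> 'a set \<Rightarrow> 'a set set" where
  "induced_edges E W = E \<inter> [W]\<^bsup>2\<^esup>"

text \<open>The set \<open>underS R x\<close> consists of the strict \<open>R\<close>-predecessors of \<open>x\<close>.\<close>

definition coloring_bound :: "'a set \<Rightarrow> 'a set set \<Rightarrow> 'b rel \<Rightarrow> bool" where
  "coloring_bound V E \<nu> \<longleftrightarrow>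
     (\<exists>R. well_order_on V R \<and> (\<forall>x\<in>V. |{y \<in> V. {x, y} \<in> E \<and> y \<in> underS R x}| <o \<nu>))"

text \<open>
  The least cardinal is taken among cardinals on the vertex type. This is no restriction:
  \<open>|V|\<close> is always a bound, and the lemma \<open>coloring_number_least\<close> below gives minimality
  among cardinals on arbitrary types. The choice is unique up to \<open>=o\<close>.
\<close>

definition coloring_number :: "'a set \<Rightarrow> 'a set set \<Rightarrow> 'a rel" where
  "coloring_number V E =
     (SOME \<nu>. Card_order \<nu> \<and> coloring_bound V E \<nu> \<and>
        (\<forall>\<nu>'::'a rel. Card_order \<nu>' \<and> coloring_bound V E \<nu>' \<longrightarrow> \<nu> \<le>o \<nu>'))"

lemma coloring_bound_card_of: "coloring_bound V E |V|"
proof -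
  have wo: "well_order_on V |V|" by (rule card_of_well_order_on)
  have "|{y \<in> V. {x, y} \<in> E \<and> y \<in> underS (card_of V) x}| <o |V|" if "x \<in> V" for x
  proof -
    have "|{y \<in> V. {x, y} \<in> E \<and> y \<in> underS (card_of V) x}| \<le>o |underS (card_of V) x|"
      by (rule card_of_mono1) auto
    also have "|underS (card_of V) x| <o |V|"
      using that by (intro card_of_underS) (auto simp: card_of_card_order_on Field_card_of)
    finally show ?thesis .
  qed
  with wo show ?thesis unfolding coloring_bound_def by blast
qed

lemma coloring_number_spec:
  "Card_order (coloring_number V E) \<and> coloring_bound V E (coloring_number V E) \<and>
   (\<forall>\<nu>'::'a rel. Card_order \<nu>' \<and> coloring_bound V E \<nu>' \<longrightarrow> coloring_number V E \<le>o \<nu>')"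
  for V :: "'a set"
proof -
  let ?S = "{\<nu>::'a rel. Card_order \<nu> \<and> coloring_bound V E \<nu>}"
  have "|V| \<in> ?S" using coloring_bound_card_of[of V E] by (simp add: card_of_Card_order)
  then have "\<exists>\<nu>\<in>?S. \<forall>\<nu>'\<in>?S. \<nu> \<le>o \<nu>'"
    by (intro exists_minim_Card_order) auto
  then have "\<exists>\<nu>::'a rel. Card_order \<nu> \<and> coloring_bound V E \<nu> \<and>
      (\<forall>\<nu>'::'a rel. Card_order \<nu>' \<and> coloring_bound V E \<nu>' \<longrightarrow> \<nu> \<le>o \<nu>')"
    by simp
  from someI_ex[OF this] show ?thesis
    unfolding coloring_number_def .
qed

lemma Card_order_coloring_number: "Card_order (coloring_number V E)"
  and coloring_bound_coloring_number: "coloring_bound V E (coloring_number V E)"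
  by (simp_all add: coloring_number_spec)

lemma coloring_bound_mono:
  assumes "coloring_bound V E \<nu>" "\<nu> \<le>o \<nu>'"
  shows "coloring_bound V E \<nu>'"
proof -
  obtain R where "well_order_on V R"
    and "\<forall>x\<in>V. |{y \<in> V. {x, y} \<in> E \<and> y \<in> underS R x}| <o \<nu>"
    using assms(1) unfolding coloring_bound_def by auto
  then show ?thesis
    unfolding coloring_bound_def using ordLess_ordLeq_trans[OF _ assms(2)] by auto
qed

lemma coloring_number_least:
  fixes V :: "'a set" and \<nu> :: "'b rel"
  assumes c: "Card_order \<nu>" and b: "coloring_bound V E \<nu>"
  shows "coloring_number V E \<le>o \<nu>"
proof (rule ccontr)
  assume "\<not> coloring_number V E \<le>o \<nu>"
  then have less: "\<nu> <o coloring_number V E"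
    using not_ordLeq_iff_ordLess[OF card_order_on_well_order_on card_order_on_well_order_on]
      c Card_order_coloring_number[of V E] by auto
  then have "|Field \<nu>| \<le>o |Field (coloring_number V E)|"
    by (intro card_of_mono2 ordLess_imp_ordLeq)
  then obtain f where f: "inj_on f (Field \<nu>)" "f ` Field \<nu> \<subseteq> Field (coloring_number V E)"
    using card_of_ordLeq[of "Field \<nu>" "Field (coloring_number V E)"] by auto
  have "|Field \<nu>| =o |f ` Field \<nu>|"
    using f(1) by (intro card_of_ordIsoI[of f] inj_on_imp_bij_betw)
  then have iso: "\<nu> =o |f ` Field \<nu>|"
    using ordIso_transitive[OF ordIso_symmetric[OF card_of_Field_ordIso[OF c]]] by simp
  then have "coloring_bound V E |f ` Field \<nu>|"
    using coloring_bound_mono[OF b ordIso_imp_ordLeq] by simp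
  then have "coloring_number V E \<le>o |f ` Field \<nu>|"
    using coloring_number_spec[of V E] card_of_Card_order[of "f ` Field \<nu>"] by auto
  then have "coloring_number V E \<le>o \<nu>"
    using ordLeq_ordIso_trans[OF _ ordIso_symmetric[OF iso]] by simp
  with not_ordLess_ordLeq[OF less] show False by simp
qed

lemma coloring_number_le_iff:
  assumes "Card_order \<nu>"
  shows "coloring_number V E \<le>o \<nu> \<longleftrightarrow> coloring_bound V E \<nu>"
  by (rule iffI) (erule coloring_bound_mono[OF coloring_bound_coloring_number], rule coloring_number_least[OF assms])

end

theory Submission
  imports Defs
begin

text \<open>
  A chain of sets each of size less than an infinite cardinal \<open>r\<close> has a union of size at most \<open>r\<close>
  (\<open>card_of_Union_chain\<close>). In other words, a set of size greater than \<open>r\<close> covered by a chain meets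
  some member of the chain in at least \<open>r\<close> points, whatever the length or the cofinality of the
  chain. The proof uses this fact twice, and each use costs one cardinal successor: this is
  where \<open>\<mu>\<^sup>+\<^sup>+\<close> comes from.

  The first use shows that for every set \<open>A\<close> of fewer than \<open>\<kappa>\<close> vertices, fewer than \<open>\<kappa>\<close> vertices
  have more than \<open>\<mu>\<close> neighbours in \<open>A\<close> (\<open>few_vertices_with_many_neighbours\<close>). Enumerate \<open>A\<close> in
  order type \<open>|A|\<close>; a vertex with more than \<open>\<mu>\<close> neighbours in \<open>A\<close> has at least \<open>\<mu>\<close> neighbours in
  some proper initial segment \<open>P\<close> of the enumeration, and \<open>|P| < |A|\<close>. If \<open>|A|\<close> many vertices had
  \<open>\<mu>\<close> neighbours in the same \<open>P\<close>, they would lie together with \<open>A\<close> in a bounded initial segment of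
  \<open>\<kappa>\<close>. In its witnessing order each of them precedes one of its neighbours in \<open>P\<close>, while each
  point of \<open>P\<close> has fewer than \<open>\<mu>\<close> neighbours before it, so there are only \<open>|P| < |A|\<close> of them, a
  contradiction. Regularity of \<open>\<kappa>\<close> then sums over the fewer than \<open>\<kappa>\<close> many \<open>P\<close>.
  Descending from \<open>A\<close> to \<open>P\<close> matters when \<open>\<kappa>\<close> is the successor of \<open>|A|\<close>: the bounded initial
  segments of \<open>\<kappa>\<close> are then too small to contain \<open>|A|\<^sup>+\<close> vertices, but not too small for \<open>|P|\<^sup>+\<close>.

  For the second use, call an initial segment \<open>D\<close> of \<open>\<kappa>\<close> closed if it contains all vertices with
  more than \<open>\<mu>\<close> neighbours in \<open>{\<beta>. \<beta> \<le> \<alpha>}\<close>, for every \<open>\<alpha> \<in> D\<close>. A vertex outside \<open>D\<close> has at most \<open>\<mu>\<close>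
  neighbours in each of these sets, which form a chain with union \<open>D\<close>, so it has at most \<open>\<mu>\<^sup>+\<close>
  neighbours in \<open>D\<close>. When \<open>\<kappa>\<close> is uncountable, every vertex lies in a bounded closed segment.
  The closed segments cut \<open>\<kappa>\<close> into bounded blocks; ordering each block by a witness for
  coloring number at most \<open>\<mu>\<close> and concatenating gives every vertex at most \<open>\<mu>\<^sup>+\<close> preceding
  neighbours in earlier blocks and fewer than \<open>\<mu>\<close> in its own. When \<open>\<kappa>\<close> is countable the bound
  holds because \<open>\<kappa> \<le> \<mu>\<close>.
\<close>

definition neighbours :: "'a set set \<Rightarrow> 'a \<Rightarrow> 'a set" where
  "neighbours E x = {y. {x, y} \<in> E}"

section \<open>Cardinalities of unions\<close>

text \<open>
  If the union had more than \<open>r\<close> points, a subset \<open>A\<close> of it of size exactly \<open>r\<close> would be too large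
  for any member \<open>X\<close> of the chain to contain it. So every \<open>X\<close> misses some \<open>a \<in> A\<close> and is therefore
  included in a member chosen to contain \<open>a\<close>: the members chosen for the \<open>r\<close> points of \<open>A\<close> already
  cover the union, which leaves it only \<open>r\<close> points.
\<close>
lemma card_of_Union_chain:
  assumes r: "Cinfinite r"
    and chain: "\<And>X Y. X \<in> C \<Longrightarrow> Y \<in> C \<Longrightarrow> X \<subseteq> Y \<or> Y \<subseteq> X"
    and small: "\<And>X. X \<in> C \<Longrightarrow> |X| <o r"
  shows "|\<Union>C| \<le>o r"
proof (rule ccontr)
  assume "\<not> |\<Union>C| \<le>o r"
  then have "r \<le>o |\<Union>C|"
    using r card_of_Well_order ordLeq_total card_order_on_well_order_on by blast
  then have "|Field r| \<le>o |\<Union>C|"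
    using card_of_Field_ordIso[of r] r ordIso_ordLeq_trans by blast
  then obtain f where f: "inj_on f (Field r)" "f ` Field r \<subseteq> \<Union>C"
    using card_of_ordLeq by metis
  define A where "A = f ` Field r"
  have "|Field r| =o |A|"
    unfolding A_def using f(1) by (intro card_of_ordIsoI[of f] inj_on_imp_bij_betw)
  then have A: "r =o |A|"
    using card_of_Field_ordIso[of r] r ordIso_symmetric ordIso_transitive by blast
  have "\<forall>a\<in>A. \<exists>X\<in>C. a \<in> X"
    using f(2) unfolding A_def by blast
  then obtain c where c: "\<And>a. a \<in> A \<Longrightarrow> c a \<in> C \<and> a \<in> c a" by metis
  have "\<Union>C \<subseteq> (\<Union>a\<in>A. c a)"
  proof
    fix y assume "y \<in> \<Union>C"
    then obtain X where X: "X \<in> C" "y \<in> X" by blast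
    have "\<not> A \<subseteq> X"
    proof
      assume "A \<subseteq> X"
      then have "r \<le>o |X|" using A card_of_mono1 ordIso_ordLeq_trans by blast
      then show False using small[OF X(1)] not_ordLess_ordLeq by blast
    qed
    then obtain a where "a \<in> A" "a \<notin> X" by blast
    then show "y \<in> (\<Union>a\<in>A. c a)" using chain[OF X(1), of "c a"] c X(2) by blast
  qed
  then have "|\<Union>C| \<le>o |\<Union>a\<in>A. c a|" by (rule card_of_mono1)
  also have "|\<Union>a\<in>A. c a| \<le>o r"
  proof (rule card_of_UNION_ordLeq_infinite_Field)
    show "\<not> finite (Field r)" "Card_order r" using r by (auto simp: cinfinite_def)
    show "|A| \<le>o r" using A ordIso_iff_ordLeq by blast
    show "\<forall>a\<in>A. |c a| \<le>o r" using c small ordLess_imp_ordLeq by blast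
  qed
  finally show False using \<open>\<not> |\<Union>C| \<le>o r\<close> by blast
qed

text \<open>
  Regularity yields a bound \<open>a\<close> that may itself belong to \<open>K\<close>; an infinite cardinal has no last
  element, so some \<open>c\<close> above \<open>a\<close> is a strict bound.
\<close>
lemma small_set_bounded:
  assumes \<kappa>: "Cinfinite \<kappa>" "regularCard \<kappa>" and K: "K \<subseteq> Field \<kappa>" "|K| <o \<kappa>"
  shows "\<exists>a\<in>Field \<kappa>. K \<subseteq> underS \<kappa> a"
proof -
  have "\<not> cofinal K \<kappa>"
    using \<kappa>(2) K not_ordLess_ordIso unfolding regularCard_def by blast
  then obtain a where a: "a \<in> Field \<kappa>" "\<And>b. b \<in> K \<Longrightarrow> a = b \<or> (a, b) \<notin> \<kappa>"
    unfolding cofinal_def by blast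
  obtain c where c: "c \<in> Field \<kappa>" "a \<noteq> c" "(a, c) \<in> \<kappa>"
    using infinite_Card_order_limit[of \<kappa> a] \<kappa>(1) a(1) by (auto simp: cinfinite_def)
  have wo: "wo_rel \<kappa>" using \<kappa>(1) card_order_on_well_order_on by (auto simp: wo_rel_def)
  note TOTALS = wo_rel.TOTALS[OF wo] and TRANS = wo_rel.TRANS[OF wo]
    and ANTISYM = wo_rel.ANTISYM[OF wo] and REFL = wo_rel.REFL[OF wo]
  have "b \<in> underS \<kappa> c" if "b \<in> K" for b
  proof -
    have "(b, a) \<in> \<kappa>" using a that K(1) TOTALS REFL unfolding refl_on_def by blast
    then show ?thesis using c TRANS ANTISYM unfolding underS_def trans_def antisym_def by blast
  qed
  then show ?thesis using c(1) by blast
qed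

section \<open>Subgraphs and counting edges\<close>

lemma coloring_bound_subset:
  assumes "coloring_bound V E \<nu>" "U \<subseteq> V"
  shows "coloring_bound U E \<nu>"
proof -
  obtain R where R: "well_order_on V R"
    and small: "\<And>x. x \<in> V \<Longrightarrow> |{y \<in> V. {x, y} \<in> E \<and> y \<in> underS R x}| <o \<nu>"
    using assms(1) unfolding coloring_bound_def by blast
  have V: "Field R = V" using R well_order_on_Well_order by blast
  have wo: "well_order_on U (Restr R U)"
    using R V assms(2) well_order_on_Restr by blast
  have "|{y \<in> U. {x, y} \<in> E \<and> y \<in> underS (Restr R U) x}| <o \<nu>" if "x \<in> U" for x
  proof -
    have "{y \<in> U. {x, y} \<in> E \<and> y \<in> underS (Restr R U) x}
        \<subseteq> {y \<in> V. {x, y} \<in> E \<and> y \<in> underS R x}"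
      using assms(2) by (auto simp: underS_def)
    then show ?thesis
      using small[of x] that assms(2) card_of_mono1 ordLeq_ordLess_trans by blast
  qed
  then show ?thesis using wo unfolding coloring_bound_def by blast
qed

lemma coloring_bound_induced_edges:
  "coloring_bound V (induced_edges E V) \<nu> \<longleftrightarrow> coloring_bound V E \<nu>"
proof -
  have "{y \<in> V. {x, y} \<in> induced_edges E V \<and> y \<in> underS R x}
      = {y \<in> V. {x, y} \<in> E \<and> y \<in> underS R x}" if "x \<in> V" for x R
    using that by (auto simp: induced_edges_def underS_def nsets_def)
  then show ?thesis unfolding coloring_bound_def by (simp cong: ball_cong)
qed

text \<open>
  A vertex of \<open>B\<close> has too many neighbours in \<open>P\<close> for all of them to precede it in the witnessing
  order. Hence \<open>B\<close> is covered by \<open>P\<close> and the sets of preceding neighbours of the points of \<open>P\<close>,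
  which are \<open>|P|\<close> many sets of size less than \<open>\<mu> \<le> |P|\<close>.
\<close>
lemma card_of_many_neighbours:
  assumes \<mu>: "Cinfinite \<mu>" and b: "coloring_bound V E \<mu>" and P: "P \<subseteq> V" and B: "B \<subseteq> V"
    and many: "\<And>x. x \<in> B \<Longrightarrow> \<mu> \<le>o |P \<inter> neighbours E x|"
  shows "|B| \<le>o |P|"
proof (cases "B = {}")
  case True
  then show ?thesis by (simp add: card_of_empty)
next
  case False
  then obtain x0 where "x0 \<in> B" by blast
  then have \<mu>P: "\<mu> \<le>o |P|"
    using many[of x0] card_of_mono1[of "P \<inter> neighbours E x0" P] ordLeq_transitive by blast
  then have inf: "\<not> finite P"
    using \<mu> natLeq_ordLeq_cinfinite infinite_iff_natLeq_ordLeq ordLeq_transitive by blast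
  obtain R where R: "well_order_on V R"
    and small: "\<And>x. x \<in> V \<Longrightarrow> |{y \<in> V. {x, y} \<in> E \<and> y \<in> underS R x}| <o \<mu>"
    using b unfolding coloring_bound_def by blast
  define Q where "Q y = {x \<in> V. {y, x} \<in> E \<and> x \<in> underS R y}" for y
  have "B \<subseteq> P \<union> (\<Union>y\<in>P. Q y)"
  proof
    fix x assume x: "x \<in> B"
    have "\<not> P \<inter> neighbours E x \<subseteq> Q x"
      using many[OF x] small[of x] x B card_of_mono1 ordLeq_transitive not_ordLess_ordLeq
      unfolding Q_def by blast
    then obtain y where y: "y \<in> P" "{x, y} \<in> E" "y \<notin> underS R x"
      using P unfolding Q_def neighbours_def by blast
    have "x = y \<or> x \<in> underS R y"
      using R x y P B unfolding well_order_on_def linear_order_on_def total_on_def underS_def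
      by blast
    then show "x \<in> P \<union> (\<Union>y\<in>P. Q y)"
      using y x B unfolding Q_def by (auto simp: insert_commute)
  qed
  then have "|B| \<le>o |P \<union> (\<Union>y\<in>P. Q y)|" by (rule card_of_mono1)
  also have "|P \<union> (\<Union>y\<in>P. Q y)| \<le>o |P|"
  proof (rule card_of_Un_ordLeq_infinite_Field)
    show "|\<Union>y\<in>P. Q y| \<le>o |P|"
    proof (rule card_of_UNION_ordLeq_infinite[OF inf])
      show "\<forall>y\<in>P. |Q y| \<le>o |P|"
        using small P \<mu>P unfolding Q_def by (meson ordLess_imp_ordLeq ordLeq_transitive subsetD)
    qed (rule card_of_mono1, simp)
    show "|P| \<le>o |P|" by (rule card_of_mono1) simp
  qed (use inf in \<open>auto simp: card_of_card_order_on Field_card_of\<close>)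
  finally show ?thesis .
qed

text \<open>
  The sets \<open>P a\<close> are the proper initial segments of an enumeration of \<open>A\<close> in order type \<open>|A|\<close>.
  Passing from \<open>A\<close> to some \<open>P a\<close> lowers the number of neighbours from more than \<open>\<mu>\<close> to at least \<open>\<mu>\<close>,
  but makes room: \<open>|A|\<close> many vertices are more than \<open>|P a|\<close> many, and still bounded in \<open>\<kappa>\<close>.
\<close>
lemma few_vertices_with_many_neighbours:
  assumes \<mu>: "Cinfinite \<mu>" and \<kappa>: "Cinfinite \<kappa>" "regularCard \<kappa>"
    and b: "\<And>\<alpha>. \<alpha> \<in> Field \<kappa> \<Longrightarrow> coloring_bound (underS \<kappa> \<alpha>) E \<mu>"
    and A: "A \<subseteq> Field \<kappa>" "|A| <o \<kappa>"
  shows "|{x \<in> Field \<kappa>. \<mu> <o |A \<inter> neighbours E x| }| <o \<kappa>" (is "|?B| <o \<kappa>")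
proof (cases "finite A")
  case True
  have "\<not> \<mu> <o |A \<inter> neighbours E x|" for x
  proof
    assume "\<mu> <o |A \<inter> neighbours E x|"
    then have "natLeq \<le>o |A \<inter> neighbours E x|"
      using natLeq_ordLeq_cinfinite[OF \<mu>] ordLess_imp_ordLeq ordLeq_transitive by blast
    then show False using True infinite_iff_natLeq_ordLeq by blast
  qed
  moreover have "|{}::'b set| <o \<kappa>"
    using \<kappa>(1) Cinfinite_gt_empty by blast
  ultimately show ?thesis by simp
next
  case False
  define P where "P a = underS |A| a" for a
  define Q where "Q a = {x \<in> Field \<kappa>. \<mu> \<le>o |P a \<inter> neighbours E x| }" for a
  have P_less: "|P a| <o |A|" if "a \<in> A" for a
    unfolding P_def using that by (intro card_of_underS) (simp_all add: card_of_card_order_on Field_card_of)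
  have P_sub: "P a \<subseteq> A" for a
    unfolding P_def using Order_Relation.underS_Field[of "|A|" a] by (simp add: Field_card_of)
  have "wo_rel |A|" using card_of_Well_order by (auto simp: wo_rel_def)
  note TOTALS = wo_rel.TOTALS[OF this] and TRANS = wo_rel.TRANS[OF this]
    and ANTISYM = wo_rel.ANTISYM[OF this]
  have cover: "?B \<subseteq> (\<Union>a\<in>A. Q a)"
  proof
    fix x assume x: "x \<in> ?B"
    let ?C = "(\<lambda>a. P a \<inter> neighbours E x) ` A"
    have "\<exists>a\<in>A. \<not> |P a \<inter> neighbours E x| <o \<mu>"
    proof (rule ccontr)
      assume "\<not> ?thesis"
      then have "|\<Union>?C| \<le>o \<mu>"
      proof (intro card_of_Union_chain[OF \<mu>])
        fix X Y assume "X \<in> ?C" "Y \<in> ?C"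
        then obtain a c where ac: "a \<in> A" "c \<in> A" "X = P a \<inter> neighbours E x" "Y = P c \<inter> neighbours E x"
          by blast
        have "P a \<subseteq> P c \<or> P c \<subseteq> P a"
          using TOTALS ac(1,2) underS_incr[OF TRANS ANTISYM] unfolding P_def Field_card_of by blast
        then show "X \<subseteq> Y \<or> Y \<subseteq> X" using ac by blast
      qed auto
      moreover have "\<Union>?C = A \<inter> neighbours E x"
      proof -
        have "\<exists>c\<in>A. a \<in> P c" if "a \<in> A" for a
          using infinite_Card_order_limit[OF card_of_Card_order, of A a] that False
          unfolding P_def underS_def by (auto simp: Field_card_of card_of_Card_order)
        then show ?thesis using P_sub by blast
      qed
      ultimately show False using x not_ordLess_ordLeq by auto
    qed
    then show "x \<in> (\<Union>a\<in>A. Q a)"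
      using x \<mu> card_of_Well_order card_order_on_well_order_on not_ordLess_iff_ordLeq
      unfolding Q_def by blast
  qed
  have "|Q a| <o \<kappa>" if a: "a \<in> A" for a
  proof -
    \<comment> \<open>\<open>|A|\<close> many vertices of \<open>Q a\<close> fit, together with \<open>P a\<close>, into one segment \<open>underS \<kappa> \<delta>\<close>, where
      they contradict \<open>card_of_many_neighbours\<close>.\<close>
    have "\<not> |A| \<le>o |Q a|"
    proof
      assume "|A| \<le>o |Q a|"
      then obtain f where f: "inj_on f A" "f ` A \<subseteq> Q a"
        using card_of_ordLeq by metis
      have fA: "|A| =o |f ` A|"
        using f(1) by (intro card_of_ordIsoI[of f] inj_on_imp_bij_betw)
      have "|A \<union> f ` A| <o \<kappa>"
      proof (rule card_of_Un_ordLess_infinite_Field)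
        show "|f ` A| <o \<kappa>" using card_of_image A(2) ordLeq_ordLess_trans by blast
      qed (use A(2) \<kappa>(1) in \<open>auto simp: cinfinite_def\<close>)
      then obtain \<delta> where \<delta>: "\<delta> \<in> Field \<kappa>" "A \<union> f ` A \<subseteq> underS \<kappa> \<delta>"
        using small_set_bounded[OF \<kappa>, of "A \<union> f ` A"] A(1) f(2) unfolding Q_def by blast
      have "|f ` A| \<le>o |P a|"
      proof (rule card_of_many_neighbours[OF \<mu> b[OF \<delta>(1)]])
        show "P a \<subseteq> underS \<kappa> \<delta>" using \<delta>(2) P_sub[of a] by blast
        show "f ` A \<subseteq> underS \<kappa> \<delta>" using \<delta>(2) by blast
        show "\<mu> \<le>o |P a \<inter> neighbours E x|" if "x \<in> f ` A" for x
          using that f(2) unfolding Q_def by blast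
      qed
      then have "|A| \<le>o |P a|" using fA ordIso_ordLeq_trans by blast
      then show False using P_less[OF a] not_ordLess_ordLeq by blast
    qed
    then have "|Q a| \<le>o |A|" using card_of_Well_order ordLeq_total by blast
    then show ?thesis using A(2) ordLeq_ordLess_trans by blast
  qed
  then have "|\<Union>a\<in>A. Q a| <o \<kappa>"
    using stable_UNION[OF regularCard_stable A(2)] \<kappa> by (auto simp: cinfinite_def)
  then show ?thesis using card_of_mono1[OF cover] ordLeq_ordLess_trans by blast
qed

section \<open>Closed initial segments\<close>

text \<open>
  Close off in \<open>\<omega>\<close> steps: each step replaces a bounded segment by a bounded one that contains the
  values of \<open>F\<close> on it, and the countably many bounds have an upper bound since \<open>\<kappa>\<close> is regular and
  uncountable.
\<close>
lemma bounded_closed_initial_segment: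
  assumes \<kappa>: "Cinfinite \<kappa>" "regularCard \<kappa>" and unc: "natLeq <o \<kappa>"
    and F: "\<And>a. a \<in> Field \<kappa> \<Longrightarrow> F a \<subseteq> Field \<kappa> \<and> |F a| <o \<kappa>"
    and x: "x \<in> Field \<kappa>"
  shows "\<exists>D. ofilter \<kappa> D \<and> (\<forall>a\<in>D. F a \<subseteq> D) \<and> x \<in> D \<and> (\<exists>\<delta>\<in>Field \<kappa>. D \<subseteq> underS \<kappa> \<delta>)"
proof -
  have wo: "wo_rel \<kappa>" using \<kappa>(1) card_order_on_well_order_on by (auto simp: wo_rel_def)
  note TRANS = wo_rel.TRANS[OF wo] and ANTISYM = wo_rel.ANTISYM[OF wo]
  have step: "\<exists>c\<in>Field \<kappa>. underS \<kappa> a \<union> (\<Union>z\<in>underS \<kappa> a. F z) \<subseteq> underS \<kappa> c"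
    if a: "a \<in> Field \<kappa>" for a
  proof (rule small_set_bounded[OF \<kappa>])
    show "underS \<kappa> a \<union> (\<Union>z\<in>underS \<kappa> a. F z) \<subseteq> Field \<kappa>"
      using F Order_Relation.underS_Field[of \<kappa> a] by blast
    have u: "|underS \<kappa> a| <o \<kappa>" by (rule card_of_underS[OF conjunct2[OF \<kappa>(1)] a])
    have "|\<Union>z\<in>underS \<kappa> a. F z| <o \<kappa>"
      using stable_UNION[OF regularCard_stable u, of F] \<kappa> F Order_Relation.underS_Field[of \<kappa> a]
      by (auto simp: cinfinite_def)
    then show "|underS \<kappa> a \<union> (\<Union>z\<in>underS \<kappa> a. F z)| <o \<kappa>"
      using card_of_Un_ordLess_infinite_Field[of \<kappa>] u \<kappa>(1) by (auto simp: cinfinite_def)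
  qed
  then obtain h where h: "\<And>a. a \<in> Field \<kappa> \<Longrightarrow>
      h a \<in> Field \<kappa> \<and> underS \<kappa> a \<union> (\<Union>z\<in>underS \<kappa> a. F z) \<subseteq> underS \<kappa> (h a)"
    by metis
  obtain s0 where s0: "s0 \<in> Field \<kappa>" "x \<in> underS \<kappa> s0"
    using infinite_Card_order_limit[of \<kappa> x] \<kappa>(1) x by (auto simp: cinfinite_def underS_def)
  define s where "s n = (h ^^ n) s0" for n
  have s: "s n \<in> Field \<kappa>" for n
    by (induction n) (use s0 h in \<open>auto simp: s_def\<close>)
  define D where "D = (\<Union>n. underS \<kappa> (s n))"
  have "|range s| \<le>o |UNIV :: nat set|" by (rule card_of_image)
  then have "|range s| <o \<kappa>"
    using card_of_nat unc ordLeq_ordIso_trans ordLeq_ordLess_trans by blast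
  then obtain \<delta> where \<delta>: "\<delta> \<in> Field \<kappa>" "range s \<subseteq> underS \<kappa> \<delta>"
    using small_set_bounded[OF \<kappa>, of "range s"] s by blast
  have "underS \<kappa> (s n) \<subseteq> underS \<kappa> \<delta>" for n
    using underS_incr[OF TRANS ANTISYM, of "s n" \<delta>] \<delta>(2) unfolding underS_def by blast
  then have bd: "D \<subseteq> underS \<kappa> \<delta>" unfolding D_def by blast
  have "F a \<subseteq> D" if a: "a \<in> D" for a
  proof -
    obtain n where "a \<in> underS \<kappa> (s n)" using a unfolding D_def by blast
    then have "F a \<subseteq> underS \<kappa> (s (Suc n))" using h[OF s[of n]] unfolding s_def by auto
    then show ?thesis unfolding D_def by blast
  qed
  moreover have "ofilter \<kappa> D"
  proof -
    have "under \<kappa> a \<subseteq> underS \<kappa> (s n)" if "a \<in> underS \<kappa> (s n)" for a n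
      using that TRANS ANTISYM unfolding under_def underS_def trans_def antisym_def by blast
    then have "under \<kappa> a \<subseteq> D" if "a \<in> D" for a
      using that unfolding D_def by blast
    then show ?thesis
      unfolding ofilter_def using bd Order_Relation.underS_Field[of \<kappa> \<delta>] by blast
  qed
  moreover have "x \<in> D"
  proof -
    have "s 0 = s0" by (simp add: s_def)
    then show ?thesis using s0(2) unfolding D_def by blast
  qed
  ultimately show ?thesis using bd \<delta>(1) by blast
qed

text \<open>
  For a family \<open>I\<close> closed under unions, \<open>d x\<close> is the largest member of \<open>I\<close> that omits \<open>x\<close>. The
  vertices with the same \<open>d x\<close> form a block, which lies inside every member of \<open>I\<close> that meets it.
  The new order compares blocks by inclusion of the values of \<open>d\<close>, and vertices of one block by an
  order witnessing the bound there. The neighbours of \<open>x\<close> in earlier blocks all lie in \<open>d x\<close>, so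
  the assumption \<open>few\<close> bounds their number.
\<close>
lemma coloring_bound_glue_closed_segments:
  fixes V :: "'a set"
  assumes W: "well_order_on V W" and \<nu>: "Cinfinite \<nu>"
    and Un: "\<And>C. C \<subseteq> I \<Longrightarrow> \<Union>C \<in> I"
    and initial: "\<And>D. D \<in> I \<Longrightarrow> ofilter W D"
    and cover: "\<And>x. x \<in> V \<Longrightarrow> \<exists>D\<in>I. x \<in> D \<and> coloring_bound D E \<nu>"
    and few: "\<And>D x. D \<in> I \<Longrightarrow> x \<in> V - D \<Longrightarrow> |D \<inter> neighbours E x| <o \<nu>"
  shows "coloring_bound V E \<nu>"
proof -
  have FW: "Field W = V" using W well_order_on_Well_order by blast
  have wo: "wo_rel W" using W FW by (auto simp: wo_rel_def)
  note TOTALS = wo_rel.TOTALS[OF wo]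
  define d where "d x = \<Union>{D \<in> I. x \<notin> D}" for x
  have d_I: "d x \<in> I" for x unfolding d_def by (rule Un) blast
  have d_notin: "x \<notin> d x" for x unfolding d_def by blast
  have d_max: "D \<subseteq> d x" if "D \<in> I" "x \<notin> D" for D x using that unfolding d_def by blast
  have d_mono: "d x \<subseteq> d y" if "(x, y) \<in> W" for x y
    using d_max[OF d_I, of y x] initial[OF d_I, of x] that d_notin[of x]
    unfolding ofilter_def under_def by blast
  have d_less: "x \<in> d y" if "d x \<subset> d y" for x y
    using d_max[OF d_I, of x y] that by blast
  have d_total: "d x \<subseteq> d y \<or> d y \<subseteq> d x" if "x \<in> V" "y \<in> V" for x y
    using d_mono TOTALS FW that by blast
  have "coloring_bound {z \<in> V. d z = d x} E \<nu>" if x: "x \<in> V" for x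
  proof -
    obtain D where D: "D \<in> I" "x \<in> D" "coloring_bound D E \<nu>" using cover[OF x] by blast
    have "z \<in> D" if "d z = d x" for z
      using d_max[OF D(1), of z] that D(2) d_notin[of x] by blast
    then show ?thesis by (intro coloring_bound_subset[OF D(3)]) blast
  qed
  then have "\<forall>K\<in>d ` V. \<exists>S. well_order_on {z \<in> V. d z = K} S \<and>
      (\<forall>x\<in>{z \<in> V. d z = K}. |{y \<in> {z \<in> V. d z = K}. {x, y} \<in> E \<and> y \<in> underS S x}| <o \<nu>)"
    unfolding coloring_bound_def by blast
  from bchoice[OF this] obtain S where
    S: "\<And>x. x \<in> V \<Longrightarrow> well_order_on {z \<in> V. d z = d x} (S (d x))"
    and S_small: "\<And>x. x \<in> V \<Longrightarrow>
      |{y \<in> {z \<in> V. d z = d x}. {x, y} \<in> E \<and> y \<in> underS (S (d x)) x}| <o \<nu>"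
    by blast
  define R where
    "R = {(x, y). x \<in> V \<and> y \<in> V \<and> (d x \<subset> d y \<or> d x = d y \<and> (x, y) \<in> S (d x))}"
  note order_defs = well_order_on_def linear_order_on_def partial_order_on_def preorder_on_def
  have "well_order_on V R"
    unfolding order_defs
  proof (intro conjI)
    show "R \<subseteq> V \<times> V" unfolding R_def by blast
    show "refl_on V R"
    proof (rule refl_onI)
      fix x assume x: "x \<in> V"
      then have "(x, x) \<in> S (d x)" using S[OF x] unfolding order_defs refl_on_def by blast
      then show "(x, x) \<in> R" using x unfolding R_def by blast
    qed
    show "trans R"
    proof (rule transI)
      fix x y z assume xy: "(x, y) \<in> R" and yz: "(y, z) \<in> R"
      have V: "x \<in> V" "z \<in> V" using xy yz unfolding R_def by auto
      show "(x, z) \<in> R"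
      proof (cases "d x = d y \<and> d y = d z")
        case True
        then have "(x, z) \<in> S (d x)"
          using xy yz S[OF V(1)] unfolding R_def order_defs trans_def by auto
        then show ?thesis using True V unfolding R_def by auto
      next
        case False
        then have "d x \<subset> d z" using xy yz unfolding R_def by auto
        then show ?thesis using V unfolding R_def by auto
      qed
    qed
    show "antisym R"
    proof (rule antisymI)
      fix x y assume xy: "(x, y) \<in> R" and yx: "(y, x) \<in> R"
      then have V: "x \<in> V" and "d x = d y" unfolding R_def by auto
      then show "x = y"
        using xy yx S[OF V] unfolding R_def order_defs antisym_def by auto
    qed
    show "total_on V R"
      unfolding total_on_def
    proof (intro ballI impI)
      fix x y assume V: "x \<in> V" "y \<in> V" and ne: "x \<noteq> y"
      show "(x, y) \<in> R \<or> (y, x) \<in> R"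
      proof (cases "d x = d y")
        case True
        then show ?thesis
          using V ne S[OF V(1)] unfolding R_def order_defs total_on_def by auto
      next
        case False
        then show ?thesis using V d_total[OF V] unfolding R_def by auto
      qed
    qed
    show "wf (R - Id)"
    proof (rule wfI_min)
      fix q and Q :: "'a set" assume q: "q \<in> Q"
      show "\<exists>z\<in>Q. \<forall>y. (y, z) \<in> R - Id \<longrightarrow> y \<notin> Q"
      proof (cases "Q \<inter> V = {}")
        case True
        then show ?thesis using q unfolding R_def by blast
      next
        case False
        \<comment> \<open>\<open>d\<close> is monotone along \<open>W\<close>, so the \<open>W\<close>-least element of \<open>Q\<close> lies in the first block
          that meets \<open>Q\<close>; a least element within that block is minimal in \<open>Q\<close>.\<close>
        define m where "m = wo_rel.minim W (Q \<inter> V)"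
        have m: "m \<in> Q" "m \<in> V" "\<And>y. y \<in> Q \<Longrightarrow> y \<in> V \<Longrightarrow> (m, y) \<in> W"
          using wo_rel.minim_in[OF wo, of "Q \<inter> V"] wo_rel.minim_least[OF wo, of "Q \<inter> V"] False FW unfolding m_def by auto
        have "wf (S (d m) - Id)" using S[OF m(2)] unfolding well_order_on_def by blast
        moreover have "m \<in> {z \<in> Q \<inter> V. d z = d m}" using m by blast
        ultimately obtain z where z: "z \<in> Q" "z \<in> V" "d z = d m"
          and z_min: "\<And>y. (y, z) \<in> S (d m) - Id \<Longrightarrow> y \<notin> {z \<in> Q \<inter> V. d z = d m}"
          by (elim wfE_min[of _ m "{z \<in> Q \<inter> V. d z = d m}"]) auto
        have "y \<notin> Q" if y: "(y, z) \<in> R - Id" for y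
        proof
          assume "y \<in> Q"
          have "y \<in> V" using y unfolding R_def by blast
          then have "d m \<subseteq> d y" using m(3) \<open>y \<in> Q\<close> d_mono by blast
          then have "d y = d m" "(y, z) \<in> S (d m) - Id" using y z(3) unfolding R_def by auto
          then show False using z_min[of y] \<open>y \<in> Q\<close> \<open>y \<in> V\<close> by blast
        qed
        then show ?thesis using z(1) by blast
      qed
    qed
  qed
  moreover have "|{y \<in> V. {x, y} \<in> E \<and> y \<in> underS R x}| <o \<nu>" if x: "x \<in> V" for x
  proof -
    let ?old = "d x \<inter> neighbours E x"
    let ?new = "{y \<in> {z \<in> V. d z = d x}. {x, y} \<in> E \<and> y \<in> underS (S (d x)) x}"
    have "{y \<in> V. {x, y} \<in> E \<and> y \<in> underS R x} \<subseteq> ?old \<union> ?new"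
      using d_less[of _ x] unfolding R_def underS_def neighbours_def by auto
    moreover have "|?old \<union> ?new| <o \<nu>"
    proof (rule card_of_Un_ordLess_infinite_Field)
      show "|?old| <o \<nu>" by (rule few) (use d_I d_notin x in auto)
      show "|?new| <o \<nu>" by (rule S_small[OF x])
    qed (use \<nu> in \<open>auto simp: cinfinite_def\<close>)
    ultimately show ?thesis using card_of_mono1 ordLeq_ordLess_trans by blast
  qed
  ultimately show ?thesis unfolding coloring_bound_def by blast
qed

text \<open>
  The segments \<open>under \<kappa> a\<close> include \<open>a\<close> itself, so that for every \<open>D\<close> in \<open>I\<close>, even one with a last
  element, the segments with \<open>a \<in> D\<close> form a chain with union \<open>D\<close>. This lets \<open>I\<close> be closed under
  arbitrary unions without any condition on limits.
\<close>
lemma coloring_bound_of_initial_segments: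
  assumes \<mu>: "Cinfinite \<mu>" and \<kappa>: "Cinfinite \<kappa>" "regularCard \<kappa>" and unc: "natLeq <o \<kappa>"
    and b: "\<And>\<alpha>. \<alpha> \<in> Field \<kappa> \<Longrightarrow> coloring_bound (underS \<kappa> \<alpha>) E \<mu>"
  shows "coloring_bound (Field \<kappa>) E (cardSuc (cardSuc \<mu>))"
proof -
  let ?\<mu>1 = "cardSuc \<mu>" and ?\<mu>2 = "cardSuc (cardSuc \<mu>)"
  have \<mu>1: "Cinfinite ?\<mu>1" by (rule Cinfinite_cardSuc[OF \<mu>])
  have \<mu>2: "Cinfinite ?\<mu>2" by (rule Cinfinite_cardSuc[OF \<mu>1])
  have less1: "\<mu> <o ?\<mu>1" by (rule cardSuc_greater[OF conjunct2[OF \<mu>]])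
  have less2: "?\<mu>1 <o ?\<mu>2" by (rule cardSuc_greater[OF conjunct2[OF \<mu>1]])
  have \<mu>\<mu>2: "\<mu> \<le>o ?\<mu>2" by (rule ordLess_imp_ordLeq[OF ordLess_transitive[OF less1 less2]])
  have wo: "well_order_on (Field \<kappa>) \<kappa>" using \<kappa>(1) card_order_on_well_order_on by blast
  have "wo_rel \<kappa>" using wo by (auto simp: wo_rel_def)
  note TOTALS = wo_rel.TOTALS[OF this] and TRANS = wo_rel.TRANS[OF this]
    and ANTISYM = wo_rel.ANTISYM[OF this] and REFL = wo_rel.REFL[OF this]
  define F where "F a = {x \<in> Field \<kappa>. \<mu> <o |under \<kappa> a \<inter> neighbours E x| }" for a
  have F_small: "|F a| <o \<kappa>" if a: "a \<in> Field \<kappa>" for a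
    unfolding F_def
  proof (rule few_vertices_with_many_neighbours[OF \<mu> \<kappa> b])
    show "under \<kappa> a \<subseteq> Field \<kappa>" by (rule under_Field)
    obtain c where c: "c \<in> Field \<kappa>" "a \<noteq> c" "(a, c) \<in> \<kappa>"
      using infinite_Card_order_limit[of \<kappa> a] \<kappa>(1) a by (auto simp: cinfinite_def)
    then have "under \<kappa> a \<subseteq> underS \<kappa> c"
      using TRANS ANTISYM unfolding under_def underS_def trans_def antisym_def by blast
    then show "|under \<kappa> a| <o \<kappa>"
      using card_of_mono1 card_of_underS[of \<kappa> c] c(1) \<kappa>(1) ordLeq_ordLess_trans by blast
  qed
  define I where "I = {D. ofilter \<kappa> D \<and> (\<forall>a\<in>D. F a \<subseteq> D)}"
  show ?thesis
  proof (rule coloring_bound_glue_closed_segments[OF wo \<mu>2, of I])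
    show "\<Union>C \<in> I" if "C \<subseteq> I" for C
      using that unfolding I_def ofilter_def by blast
    show "ofilter \<kappa> D" if "D \<in> I" for D using that unfolding I_def by blast
    show "\<exists>D\<in>I. x \<in> D \<and> coloring_bound D E ?\<mu>2" if x: "x \<in> Field \<kappa>" for x
    proof -
      obtain D \<delta> where D: "D \<in> I" "x \<in> D" and \<delta>: "\<delta> \<in> Field \<kappa>" "D \<subseteq> underS \<kappa> \<delta>"
        using bounded_closed_initial_segment[OF \<kappa> unc _ x, of F] F_small
        unfolding I_def F_def by blast
      have "coloring_bound D E ?\<mu>2"
        using coloring_bound_mono[OF coloring_bound_subset[OF b[OF \<delta>(1)] \<delta>(2)] \<mu>\<mu>2] .
      then show ?thesis using D by blast
    qed
    show "|D \<inter> neighbours E x| <o ?\<mu>2" if D: "D \<in> I" and x: "x \<in> Field \<kappa> - D" for D x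
    proof -
      let ?C = "(\<lambda>a. under \<kappa> a \<inter> neighbours E x) ` D"
      have DF: "D \<subseteq> Field \<kappa>" using D unfolding I_def ofilter_def by blast
      have small: "|\<Union>?C| \<le>o ?\<mu>1"
      proof (rule card_of_Union_chain[OF \<mu>1])
        fix X Y assume "X \<in> ?C" "Y \<in> ?C"
        then obtain a c where ac: "a \<in> D" "c \<in> D"
          "X = under \<kappa> a \<inter> neighbours E x" "Y = under \<kappa> c \<inter> neighbours E x"
          by blast
        have "under \<kappa> a \<subseteq> under \<kappa> c \<or> under \<kappa> c \<subseteq> under \<kappa> a"
          using TOTALS ac DF under_incr[OF TRANS] by blast
        then show "X \<subseteq> Y \<or> Y \<subseteq> X" using ac by blast
      next
        fix X assume "X \<in> ?C"
        then obtain a where a: "a \<in> D" "X = under \<kappa> a \<inter> neighbours E x" by blast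
        have "x \<notin> F a" using a(1) D x unfolding I_def by blast
        then have "\<not> \<mu> <o |X|" using x a(2) unfolding F_def by blast
        then have "|X| \<le>o \<mu>"
          using \<mu> card_of_Well_order card_order_on_well_order_on not_ordLess_iff_ordLeq by blast
        then show "|X| <o ?\<mu>1" using less1 ordLeq_ordLess_trans by blast
      qed
      have sub: "D \<inter> neighbours E x \<subseteq> \<Union>?C"
        using DF REFL unfolding under_def refl_on_def by blast
      show ?thesis
        by (rule ordLeq_ordLess_trans[OF ordLeq_transitive[OF card_of_mono1[OF sub] small] less2])
    qed
  qed
qed

theorem corollary2p18:
  fixes \<mu> :: "'m rel" and \<kappa> :: "'k rel" and E :: "'k set set"
  assumes "Cinfinite \<mu>"
    and "Cinfinite \<kappa>" and "regularCard \<kappa>"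
    and "is_graph (Field \<kappa>) E"
    and "\<And>\<alpha>. \<alpha> \<in> Field \<kappa> \<Longrightarrow>
           coloring_number (underS \<kappa> \<alpha>) (induced_edges E (underS \<kappa> \<alpha>)) \<le>o \<mu>"
  shows "coloring_number (Field \<kappa>) E \<le>o cardSuc (cardSuc \<mu>)"
proof -
  have \<mu>2: "Cinfinite (cardSuc (cardSuc \<mu>))" by (intro Cinfinite_cardSuc assms(1))
  have "coloring_bound (Field \<kappa>) E (cardSuc (cardSuc \<mu>))"
  proof (cases "natLeq <o \<kappa>")
    case True
    have "coloring_bound (underS \<kappa> \<alpha>) E \<mu>" if "\<alpha> \<in> Field \<kappa>" for \<alpha>
      using assms(5)[OF that] assms(1) coloring_number_le_iff coloring_bound_induced_edges by blast
    then show ?thesis by (rule coloring_bound_of_initial_segments[OF assms(1-3) True])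
  next
    case False
    then have "\<kappa> \<le>o natLeq"
      using assms(2) card_order_on_well_order_on natLeq_Well_order not_ordLess_iff_ordLeq by blast
    then have "\<kappa> \<le>o cardSuc (cardSuc \<mu>)"
      using natLeq_ordLeq_cinfinite[OF \<mu>2] ordLeq_transitive by blast
    then have "|Field \<kappa>| \<le>o cardSuc (cardSuc \<mu>)"
      using card_of_Field_ordIso[of \<kappa>] assms(2) ordIso_ordLeq_trans by blast
    then show ?thesis by (rule coloring_bound_mono[OF coloring_bound_card_of])
  qed
  then show ?thesis by (rule coloring_number_least[OF conjunct2[OF \<mu>2]])
qed

end
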